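(* Every finite simple connected graph $G$ (with non-empty vertex set) that is square-stable, i.e. satisfies $\alpha(G)=\alpha(G^2)$, is $\alpha^+$-stable.
   Context: $G^2$ is the graph on $V(G)$ in which distinct vertices $v,w$ are adjacent iff $\mathrm{dist}_G(v,w)\le 2$. $\alpha(G)$ is the maximum cardinality of a stable (independent) set. $G$ is $\alpha^+$-stable if $\alpha(G+e)=\alpha(G)$ for every edge $e$ of the complement $\overline{G}$. *)

theory Defs
  imports "Graph_Theory.Graph_Theory"
begin

text \<open>
  A finite simple graph is a \<^locale>\<open>pair_graph\<close>: an undirected edge \<open>vw\<close> is the pair of arcs
  \<open>(v, w)\<close>, \<open>(w, v)\<close>. The library predicate \<open>Digraph_Component.connected\<close> excludes the graph
  without vertices.
\<close>

text \<open>
  The least number of edges of a walk from \<open>v\<close> to \<open>w\<close>, that is, the library's shortest-path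
  distance for unit weights; it is \<open>\<infinity>\<close> if there is no walk.
\<close>

definition graph_dist :: "'a pair_pre_digraph \<Rightarrow> 'a \<Rightarrow> 'a \<Rightarrow> ereal" where
  "graph_dist G v w = wf_digraph.\<mu> (with_proj G) (\<lambda>_. 1) v w"

definition graph_square :: "'a pair_pre_digraph \<Rightarrow> 'a pair_pre_digraph" where
  "graph_square G =
     \<lparr> pverts = pverts G,
       parcs = {(v, w). v \<in> pverts G \<and> w \<in> pverts G \<and> v \<noteq> w \<and> graph_dist G v w \<le> 2} \<rparr>"

definition graph_complement :: "'a pair_pre_digraph \<Rightarrow> 'a pair_pre_digraph" where
  "graph_complement G =
     \<lparr> pverts = pverts G,
       parcs = {(v, w). v \<in> pverts G \<and> w \<in> pverts G \<and> v \<noteq> w \<and> (v, w) \<notin> parcs G} \<rparr>"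

definition add_edge :: "'a pair_pre_digraph \<Rightarrow> 'a \<Rightarrow> 'a \<Rightarrow> 'a pair_pre_digraph" where
  "add_edge G v w = \<lparr> pverts = pverts G, parcs = parcs G \<union> {(v, w), (w, v)} \<rparr>"

definition stable_set :: "'a pair_pre_digraph \<Rightarrow> 'a set \<Rightarrow> bool" where
  "stable_set G S \<longleftrightarrow> S \<subseteq> pverts G \<and> (\<forall>v\<in>S. \<forall>w\<in>S. (v, w) \<notin> parcs G)"

definition stability_number :: "'a pair_pre_digraph \<Rightarrow> nat" where
  "stability_number G = Max {card S | S. stable_set G S}"

definition square_stable :: "'a pair_pre_digraph \<Rightarrow> bool" where
  "square_stable G \<longleftrightarrow> stability_number G = stability_number (graph_square G)"

definition alpha_plus_stable :: "'a pair_pre_digraph \<Rightarrow> bool" where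
  "alpha_plus_stable G \<longleftrightarrow>
     (\<forall>(v, w) \<in> parcs (graph_complement G).
        stability_number (add_edge G v w) = stability_number G)"

end

theory Submission
  imports Defs
begin

text \<open>
  Take a stable set \<open>S\<close> of the square of \<open>G\<close> with \<open>\<alpha>(G)\<close> elements; square-stability provides it.
  Distinct elements of \<open>S\<close> are at distance at least three in \<open>G\<close>, so \<open>S\<close> is a maximum stable set
  of \<open>G\<close>, and it stays stable if one of its vertices \<open>v\<close> is exchanged for a neighbour \<open>u\<close> of \<open>v\<close>:
  a neighbour of \<open>u\<close> in \<open>S\<close> other than \<open>v\<close> would be at distance at most two from \<open>v\<close>
  (\<open>square_stable_set_exchange\<close>).

  Adding an edge \<open>vw\<close> destroys only those stable sets that contain both \<open>v\<close> and \<open>w\<close>. If \<open>S\<close> is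
  one of them, the exchange at \<open>v\<close> yields a stable set of the same size that avoids \<open>v\<close>. The
  neighbour of \<open>v\<close> that this requires exists because \<open>G\<close> is connected and has a second vertex,
  namely \<open>w\<close>. Hence \<open>\<alpha>\<close> does not drop; adding an edge never increases it.
\<close>

lemma stable_set_card_finite:
  assumes "finite (pverts G)"
  shows "finite {card S | S. stable_set G S}"
proof -
  have "{card S | S. stable_set G S} \<subseteq> card ` Pow (pverts G)"
    by (auto simp: stable_set_def)
  then show ?thesis
    using assms by (meson finite_Pow_iff finite_imageI finite_subset)
qed

lemma stable_set_card_le:
  assumes "finite (pverts G)" "stable_set G S"
  shows "card S \<le> stability_number G"
  unfolding stability_number_def
  using stable_set_card_finite[OF assms(1)] assms(2) by (auto intro!: Max_ge)

lemma maximum_stable_set_exists: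
  assumes "finite (pverts G)"
  obtains S where "stable_set G S" "card S = stability_number G"
proof -
  have "stable_set G {}" by (simp add: stable_set_def)
  then have "{card S | S. stable_set G S} \<noteq> {}" by auto
  then have "stability_number G \<in> {card S | S. stable_set G S}"
    unfolding stability_number_def using stable_set_card_finite[OF assms] by (rule Max_in[rotated])
  then show thesis using that by auto
qed

lemma stability_number_add_edge_le:
  assumes "finite (pverts G)"
  shows "stability_number (add_edge G v w) \<le> stability_number G"
proof -
  have "finite (pverts (add_edge G v w))" using assms by (simp add: add_edge_def)
  then obtain S where S: "stable_set (add_edge G v w) S"
      "card S = stability_number (add_edge G v w)"
    by (rule maximum_stable_set_exists)
  have "stable_set G S" using S(1) by (auto simp: stable_set_def add_edge_def)
  then show ?thesis using stable_set_card_le[OF assms] S(2) by metis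
qed

lemma stable_set_add_edge:
  assumes "stable_set G S" "v \<notin> S \<or> w \<notin> S"
  shows "stable_set (add_edge G v w) S"
  using assms by (auto simp: stable_set_def add_edge_def)

context pair_graph
begin

lemma square_arc_if_arc:
  assumes "(v, w) \<in> parcs G"
  shows "(v, w) \<in> parcs (graph_square G)"
proof -
  have "awalk v [(v, w)] w" using assms by (auto simp: awalk_simps in_arcsD2)
  from min_cost_le_walk_cost[OF this, of "\<lambda>_. 1"]
  have "graph_dist G v w \<le> 1" by (simp add: graph_dist_def one_ereal_def)
  also have "(1 :: ereal) \<le> 2" by simp
  finally have "graph_dist G v w \<le> 2" .
  then show ?thesis
    using assms no_loops' by (auto simp: graph_square_def in_arcsD1 in_arcsD2)
qed

lemma square_arc_if_common_neighbour:
  assumes "(v, u) \<in> parcs G" "(u, w) \<in> parcs G" "v \<noteq> w"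
  shows "(v, w) \<in> parcs (graph_square G)"
proof -
  have "awalk v [(v, u), (u, w)] w" using assms by (auto simp: awalk_simps in_arcsD2)
  from min_cost_le_walk_cost[OF this, of "\<lambda>_. 1"]
  have "graph_dist G v w \<le> 2" by (simp add: graph_dist_def)
  then show ?thesis
    using assms by (auto simp: graph_square_def in_arcsD1 in_arcsD2)
qed

lemma stable_set_if_square_stable_set:
  assumes "stable_set (graph_square G) S"
  shows "stable_set G S"
proof -
  have "pverts (graph_square G) = pverts G" by (simp add: graph_square_def)
  then show ?thesis
    using assms square_arc_if_arc unfolding stable_set_def by blast
qed

text \<open>
  Balls of radius one around the elements of \<open>S\<close> are disjoint, so \<open>v\<close> is the only element of \<open>S\<close>
  in the closed neighbourhood of \<open>u\<close>.
\<close>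

lemma square_stable_set_exchange:
  assumes S: "stable_set (graph_square G) S" and "v \<in> S" and vu: "(v, u) \<in> parcs G"
  shows "stable_set G (insert u (S - {v}))"
    and "card (insert u (S - {v})) = card S"
proof -
  have uv: "(u, v) \<in> parcs G" using vu by (rule arcs_symmetric)
  have stable: "stable_set G S" using S by (rule stable_set_if_square_stable_set)
  have no_arc: "(u, x) \<notin> parcs G" if "x \<in> S - {v}" for x
    using that S \<open>v \<in> S\<close> square_arc_if_common_neighbour[OF vu, of x]
    by (auto simp: stable_set_def)
  then have no_arc': "(x, u) \<notin> parcs G" if "x \<in> S - {v}" for x
    using that arcs_symmetric by blast
  have "u \<in> pverts G" using vu by (rule in_arcsD2)
  then show "stable_set G (insert u (S - {v}))"
    using stable no_arc no_arc' no_loops'[of u u] by (auto simp: stable_set_def)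
  have "u \<notin> S" using stable \<open>v \<in> S\<close> vu by (auto simp: stable_set_def)
  moreover have "finite S"
    using stable pair_finite_verts by (auto simp: stable_set_def intro: finite_subset)
  ultimately show "card (insert u (S - {v})) = card S"
    using card.remove[of S v] \<open>v \<in> S\<close> by simp
qed

lemma connected_neighbour_exists:
  assumes "Digraph_Component.connected (with_proj G)"
    and "v \<in> pverts G" "w \<in> pverts G" "v \<noteq> w"
  obtains u where "(v, u) \<in> parcs G"
proof -
  have "strongly_connected (with_proj G)"
    using sym_arcs assms(1) by (rule symmetric_connected_imp_strongly_connected)
  then have "v \<rightarrow>\<^sup>*\<^bsub>with_proj G\<^esub> w"
    using assms(2,3) by (auto simp: strongly_connected_def)
  then obtain p where "awalk v p w" by (auto simp: reachable_awalk)
  then show thesis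
    using \<open>v \<noteq> w\<close> that by (cases p) (auto simp: awalk_simps)
qed

end

theorem corollary2p10:
  fixes G :: "'a pair_pre_digraph"
  assumes "pair_graph G"
    and "Digraph_Component.connected (with_proj G)"
    and "square_stable G"
  shows "alpha_plus_stable G"
proof -
  interpret pair_graph G by fact
  have fin: "finite (pverts G)" by (rule pair_finite_verts)
  then have "finite (pverts (graph_square G))" by (simp add: graph_square_def)
  then obtain S where S: "stable_set (graph_square G) S"
      "card S = stability_number (graph_square G)"
    by (rule maximum_stable_set_exists)
  then have card_S: "card S = stability_number G"
    using \<open>square_stable G\<close> by (simp add: square_stable_def)
  have "stability_number (add_edge G v w) = stability_number G"
    if vw: "(v, w) \<in> parcs (graph_complement G)" for v w
  proof -
    have "v \<in> pverts G" "w \<in> pverts G" "v \<noteq> w"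
      using vw by (auto simp: graph_complement_def)
    then obtain u where vu: "(v, u) \<in> parcs G"
      using connected_neighbour_exists \<open>Digraph_Component.connected (with_proj G)\<close> by blast
    obtain T where T: "stable_set G T" "card T = card S" "v \<notin> T"
    proof (cases "v \<in> S")
      case True
      then show thesis
        using that[of "insert u (S - {v})"] square_stable_set_exchange[OF S(1) _ vu]
          no_loops'[OF vu] by auto
    next
      case False
      then show thesis using that stable_set_if_square_stable_set[OF S(1)] by blast
    qed
    have "finite (pverts (add_edge G v w))" using fin by (simp add: add_edge_def)
    moreover have "stable_set (add_edge G v w) T" using T by (intro stable_set_add_edge) auto
    ultimately have "card T \<le> stability_number (add_edge G v w)" by (rule stable_set_card_le)
    then show ?thesis
      using stability_number_add_edge_le[OF fin, of v w] T(2) card_S by simp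
  qed
  then show ?thesis by (auto simp: alpha_plus_stable_def)
qed

end
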